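(* Let $C_1$ be the smallest constant $C$ such that for every integer $n\ge 1$ and every function $f:\{-1,1\}^n\to\mathbb{R}$, $$\mathbb{E}|f-\mathbb{E}f|\le C\,\mathbb{E}|\nabla f| .$$ Then $C_1<\frac{\pi}{2}$.
   Context: Here $\mathbb{E}$ denotes expectation with respect to the uniform probability measure on the Hamming cube $\{-1,1\}^n$. For $f:\{-1,1\}^n\to\mathbb{R}$ and $1\le k\le n$, the discrete partial derivative is $\partial_k f(x)=\frac12\big(f(x^{k\to 1})-f(x^{k\to -1})\big)$, where $x^{k\to\pm1}$ is $x$ with its $k$-th coordinate replaced by $\pm 1$. The gradient is $\nabla f=(\partial_1 f,\dots,\partial_n f)$ and $|\nabla f|(x)=\big(\sum_{k=1}^n |\partial_k f(x)|^2\big)^{1/2}$. *)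

theory Defs
  imports "HOL-Probability.Probability"
begin

text \<open>Points of the cube are extensional functions on the index set, so that the set of
  points has exactly \<open>2 ^ n\<close> elements.\<close>

definition hamming_cube :: "nat \<Rightarrow> (nat \<Rightarrow> real) set" where
  "hamming_cube n = {1..n} \<rightarrow>\<^sub>E {-1, 1}"

definition cube_expectation :: "nat \<Rightarrow> ((nat \<Rightarrow> real) \<Rightarrow> real) \<Rightarrow> real" where
  "cube_expectation n f = measure_pmf.expectation (pmf_of_set (hamming_cube n)) f"

definition discrete_partial :: "nat \<Rightarrow> ((nat \<Rightarrow> real) \<Rightarrow> real) \<Rightarrow> (nat \<Rightarrow> real) \<Rightarrow> real" where
  "discrete_partial k f x = (f (x(k := 1)) - f (x(k := -1))) / 2"

definition gradient_norm :: "nat \<Rightarrow> ((nat \<Rightarrow> real) \<Rightarrow> real) \<Rightarrow> (nat \<Rightarrow> real) \<Rightarrow> real" where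
  "gradient_norm n f x = sqrt (\<Sum>k = 1..n. \<bar>discrete_partial k f x\<bar>\<^sup>2)"

text \<open>A function on the cube is represented by a total function; only its values on
  \<open>hamming_cube n\<close> enter the inequality.\<close>

definition L1_Poincare :: "real \<Rightarrow> bool" where
  "L1_Poincare C \<longleftrightarrow> (\<forall>n \<ge> 1. \<forall>f :: (nat \<Rightarrow> real) \<Rightarrow> real.
     cube_expectation n (\<lambda>x. \<bar>f x - cube_expectation n f\<bar>)
       \<le> C * cube_expectation n (gradient_norm n f))"

definition C\<^sub>1 :: real where
  "C\<^sub>1 = (LEAST C. L1_Poincare C)"

end

theory Submission imports Defs begin

text \<open>
  Let \<open>g = sgn (f - E f)\<close> and let \<open>P\<^sub>r g (y)\<close> be the mean of \<open>g\<close> under the product measure on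
  the cube whose \<open>j\<close>-th coordinate has mean \<open>r * y j\<close>. As \<open>P\<^sub>1\<close> is the identity and \<open>P\<^sub>0\<close> the
  expectation, \<open>F r = E (f * P\<^sub>r g)\<close> runs from \<open>E f * E g\<close> at \<open>r = 0\<close> to \<open>E (f * g)\<close> at \<open>r = 1\<close>,
  and \<open>F 1 - F 0\<close> is exactly \<open>E \<bar>f - E f\<bar>\<close>. Differentiating the product weights and pairing
  points that differ in one coordinate (\<open>noise_pairing_deriv\<close>) gives
  \<open>(1 - r\<^sup>2) * F' r = E\<^sub>y E\<^sub>x (g x * S)\<close> with \<open>S = (\<Sum>j. (x j - r * y j) * \<partial>\<^sub>j f (y))\<close>, where \<open>x\<close> is
  distributed as in \<open>P\<^sub>r\<close>. Given \<open>y\<close>, \<open>S\<close> is a sum of independent centered variables, so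
  \<open>E\<^sub>x \<bar>S\<bar> \<le> sqrt (1 - r\<^sup>2) * \<bar>\<nabla>f\<bar>(y)\<close> by Cauchy--Schwarz. Hence
  \<open>F' r \<le> E \<bar>\<nabla>f\<bar> / sqrt (1 - r\<^sup>2)\<close>, the derivative of \<open>E \<bar>\<nabla>f\<bar> * arcsin r\<close>, and comparing \<open>F\<close>
  with the arcsine over \<open>[0, 1]\<close> yields the constant \<open>\<pi> / 2\<close>.

  The gain comes from Cauchy--Schwarz never being sharp, uniformly in the coefficients, for
  \<open>r\<close> in a fixed compact subinterval of \<open>(0, 1)\<close>. Equality would make \<open>\<bar>S\<bar>\<close> constant, hence
  \<open>E S\<^sup>4 = (E S\<^sup>2)\<^sup>2\<close>. But a biased coin with \<open>r\<^sup>2 \<ge> 1/3\<close> has \<open>E X\<^sup>4 \<ge> 3 * (E X\<^sup>2)\<^sup>2\<close>, and this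
  inequality passes to sums of independent centered variables (\<open>centered_moment4\<close>), so
  \<open>E S\<^sup>4 \<ge> 3 * (E S\<^sup>2)\<^sup>2\<close>. A bound on \<open>E S\<^sup>6\<close> (\<open>centered_moment6\<close>) prevents this excess from
  sitting in a tail of negligible probability; together they improve Cauchy--Schwarz by a fixed
  factor on \<open>3/5 \<le> r \<le> 4/5\<close> (\<open>centered_abs_moment_improved\<close>), and therefore improve the
  comparison of \<open>F\<close> with the arcsine by a fixed multiple of \<open>E \<bar>\<nabla>f\<bar>\<close>.
\<close>

section \<open>Product measures on the cube\<close>

text \<open>Expectation under the product measure for which coordinate \<open>j\<close> is \<open>1\<close> with probability
  \<open>(1 + m j) / 2\<close>, hence has mean \<open>m j\<close>.\<close>

definition biased_mean :: "nat \<Rightarrow> (nat \<Rightarrow> real) \<Rightarrow> ((nat \<Rightarrow> real) \<Rightarrow> real) \<Rightarrow> real" where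
  "biased_mean n m \<phi> = (\<Sum>x\<in>hamming_cube n. (\<Prod>j=1..n. (1 + m j * x j) / 2) * \<phi> x)"

definition centered_sum :: "nat \<Rightarrow> (nat \<Rightarrow> real) \<Rightarrow> (nat \<Rightarrow> real) \<Rightarrow> (nat \<Rightarrow> real) \<Rightarrow> real" where
  "centered_sum n m b x = (\<Sum>j=1..n. (x j - m j) * b j)"

lemma finite_hamming_cube: "finite (hamming_cube n)"
  by (simp add: hamming_cube_def finite_PiE)

lemma hamming_cube_values: "x \<in> hamming_cube n \<Longrightarrow> j \<in> {1..n} \<Longrightarrow> x j = 1 \<or> x j = -1"
  by (auto simp: hamming_cube_def PiE_def Pi_def)

lemma card_hamming_cube: "card (hamming_cube n) = 2 ^ n"
  by (simp add: hamming_cube_def card_PiE numeral_2_eq_2)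

lemma cube_expectation_sum: "cube_expectation n f = (\<Sum>x\<in>hamming_cube n. f x) / 2 ^ n"
proof -
  have "hamming_cube n \<noteq> {}"
    using card_hamming_cube[of n] by auto
  then show ?thesis
    by (simp add: cube_expectation_def integral_pmf_of_set finite_hamming_cube card_hamming_cube)
qed

lemma sum_hamming_cube_Suc:
  "(\<Sum>x\<in>hamming_cube (Suc n). \<phi> x)
     = (\<Sum>x\<in>hamming_cube n. \<phi> (x(Suc n := 1)) + \<phi> (x(Suc n := -1)))"
proof -
  have eq: "hamming_cube (Suc n) = (\<lambda>(s, x). x(Suc n := s)) ` ({-1, 1} \<times> hamming_cube n)"
    unfolding hamming_cube_def by (simp add: atLeastAtMostSuc_conv PiE_insert_eq)
  have inj: "inj_on (\<lambda>(s, x). x(Suc n := s)) ({-1, 1} \<times> hamming_cube n)"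
    unfolding hamming_cube_def by (rule inj_combinator) auto
  have "(\<Sum>x\<in>hamming_cube (Suc n). \<phi> x)
     = (\<Sum>(s, x)\<in>{-1, 1} \<times> hamming_cube n. \<phi> (x(Suc n := s)))"
    unfolding eq by (subst sum.reindex[OF inj]) (simp add: case_prod_unfold)
  also have "\<dots> = (\<Sum>s\<in>{-1, 1}. \<Sum>x\<in>hamming_cube n. \<phi> (x(Suc n := s)))"
    by (simp add: sum.cartesian_product)
  also have "\<dots> = (\<Sum>x\<in>hamming_cube n. \<phi> (x(Suc n := 1)) + \<phi> (x(Suc n := -1)))"
    by (simp add: sum.distrib add.commute)
  finally show ?thesis .
qed

lemma biased_mean_Suc:
  "biased_mean (Suc n) m \<phi> = biased_mean n m
     (\<lambda>x. (1 + m (Suc n)) / 2 * \<phi> (x(Suc n := 1)) + (1 - m (Suc n)) / 2 * \<phi> (x(Suc n := -1)))"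
proof -
  have "(\<Prod>j=1..n. (1 + m j * (x(Suc n := s)) j) / 2) = (\<Prod>j=1..n. (1 + m j * x j) / 2)" for x s
    by (rule prod.cong) auto
  then show ?thesis
    unfolding biased_mean_def sum_hamming_cube_Suc
    by (intro sum.cong refl) (simp add: algebra_simps del: fun_upd_apply, simp add: algebra_simps)
qed

lemma biased_mean_add:
  "biased_mean n m (\<lambda>x. \<phi> x + \<psi> x) = biased_mean n m \<phi> + biased_mean n m \<psi>"
  by (simp add: biased_mean_def sum.distrib algebra_simps)

lemma biased_mean_mult: "biased_mean n m (\<lambda>x. c * \<phi> x) = c * biased_mean n m \<phi>"
  by (simp add: biased_mean_def sum_distrib_left algebra_simps)

lemma biased_mean_const: "biased_mean n m (\<lambda>x. c) = c"
proof (induction n)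
  case 0
  then show ?case by (simp add: biased_mean_def hamming_cube_def)
next
  case (Suc n)
  have "(1 + m (Suc n)) / 2 * c + (1 - m (Suc n)) / 2 * c = c"
    by (simp add: field_simps)
  then show ?case unfolding biased_mean_Suc using Suc by simp
qed

lemma biased_mean_mono:
  assumes m: "\<And>j. j \<in> {1..n} \<Longrightarrow> \<bar>m j\<bar> \<le> 1"
    and le: "\<And>x. x \<in> hamming_cube n \<Longrightarrow> \<phi> x \<le> \<psi> x"
  shows "biased_mean n m \<phi> \<le> biased_mean n m \<psi>"
  unfolding biased_mean_def
proof (intro sum_mono mult_left_mono le prod_nonneg)
  fix x j assume "x \<in> hamming_cube n" "j \<in> {1..n}"
  with m[of j] hamming_cube_values[of x n j] show "0 \<le> (1 + m j * x j) / 2" by auto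
qed

text \<open>Integrating out the last coordinate: this is the step of every moment computation below,
  which proceeds by induction on the number of coordinates.\<close>

lemma biased_mean_centered_sum_Suc:
  "biased_mean (Suc n) m (\<lambda>x. \<phi> (centered_sum (Suc n) m b x)) = biased_mean n m
     (\<lambda>x. (1 + m (Suc n)) / 2 * \<phi> (centered_sum n m b x + (1 - m (Suc n)) * b (Suc n))
        + (1 - m (Suc n)) / 2 * \<phi> (centered_sum n m b x - (1 + m (Suc n)) * b (Suc n)))"
proof -
  have "centered_sum (Suc n) m b (x(Suc n := s)) = centered_sum n m b x + (s - m (Suc n)) * b (Suc n)"
    for x s
    by (simp add: centered_sum_def)
  moreover have "(-1 - m (Suc n)) * b (Suc n) = - ((1 + m (Suc n)) * b (Suc n))"
    by (simp add: algebra_simps)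
  ultimately show ?thesis unfolding biased_mean_Suc by simp
qed

section \<open>Moments of centered sums\<close>

lemma two_point_moment1:
  "(1 + m) / 2 * (s + (1 - m) * b) + (1 - m) / 2 * (s - (1 + m) * b) = (s::real)"
  by (simp add: field_simps)

lemma two_point_moment2:
  "(1 + m) / 2 * (s + (1 - m) * b)^2 + (1 - m) / 2 * (s - (1 + m) * b)^2 = s^2 + (1 - m^2) * (b::real)^2"
  by (simp add: field_simps) algebra

lemma two_point_moment4:
  "(1 + m) / 2 * (s + (1 - m) * b)^4 + (1 - m) / 2 * (s - (1 + m) * b)^4
     = s^4 + 6 * (1 - m^2) * b^2 * s^2 - 8 * m * (1 - m^2) * b^3 * s
       + (1 - m^2) * (1 + 3 * m^2) * (b::real)^4"
  by (simp add: field_simps) algebra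

lemma two_point_moment6:
  "(1 + m) / 2 * (s + (1 - m) * b)^6 + (1 - m) / 2 * (s - (1 + m) * b)^6
     = s^6 + 15 * (1 - m^2) * b^2 * s^4 - 40 * m * (1 - m^2) * b^3 * s^3
       + 15 * (1 - m^2) * (1 + 3 * m^2) * b^4 * s^2
       - 24 * m * (1 - m^4) * b^5 * s
       + (1 - m^2) * (1 + 10 * m^2 + 5 * m^4) * (b::real)^6"
  by (simp add: field_simps) algebra

lemma centered_moment1: "biased_mean n m (centered_sum n m b) = 0"
proof (induction n)
  case 0
  then show ?case by (simp add: biased_mean_def centered_sum_def)
next
  case (Suc n)
  then show ?case
    using biased_mean_centered_sum_Suc[of n m "\<lambda>s. s" b, unfolded two_point_moment1] by simp
qed

lemma centered_moment2:
  assumes "\<And>j. j \<in> {1..n} \<Longrightarrow> (m j)^2 = r^2"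
  shows "biased_mean n m (\<lambda>x. (centered_sum n m b x)^2) = (1 - r^2) * (\<Sum>j=1..n. (b j)^2)"
  using assms
proof (induction n)
  case 0
  then show ?case by (simp add: biased_mean_def centered_sum_def)
next
  case (Suc n)
  have mr: "(m (Suc n))^2 = r^2" using Suc.prems by simp
  have IH: "biased_mean n m (\<lambda>x. (centered_sum n m b x)^2) = (1 - r^2) * (\<Sum>j=1..n. (b j)^2)"
    using Suc.prems by (intro Suc.IH) auto
  show ?case
    unfolding biased_mean_centered_sum_Suc[where \<phi> = "\<lambda>s. s^2"] two_point_moment2 biased_mean_add biased_mean_const IH mr
    by (simp add: algebra_simps)
qed

text \<open>A centered coin of variance \<open>v = 1 - r\<^sup>2\<close> has fourth moment \<open>v * (1 + 3 * r\<^sup>2)\<close>, which is at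
  least \<open>3 * v\<^sup>2\<close> precisely because \<open>r\<^sup>2 \<ge> 1/3\<close>; for independent centered variables the excess
  \<open>E S\<^sup>4 - 3 * (E S\<^sup>2)\<^sup>2\<close> is additive, hence stays nonnegative.\<close>

lemma centered_moment4:
  fixes b :: "nat \<Rightarrow> real"
  assumes "\<And>j. j \<in> {1..n} \<Longrightarrow> (m j)^2 = r^2" and r: "1/3 \<le> r^2" "r^2 \<le> 1"
  defines "A \<equiv> (\<Sum>j=1..n. (b j)^2)"
  shows "3 * (1 - r^2)^2 * A^2 \<le> biased_mean n m (\<lambda>x. (centered_sum n m b x)^4)"
    and "biased_mean n m (\<lambda>x. (centered_sum n m b x)^4) \<le> 4 * A^2"
  unfolding A_def using assms(1)
proof (induction n)
  case 0
  { case 1 then show ?case by (simp add: biased_mean_def centered_sum_def) }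
  { case 2 then show ?case by (simp add: biased_mean_def centered_sum_def) }
next
  case (Suc n)
  define A where "A = (\<Sum>j=1..n. (b j)^2)"
  define v where "v = 1 - r^2"
  define c where "c = b (Suc n)"
  define \<mu> where "\<mu> = v * (1 + 3 * r^2)"
  have A: "0 \<le> A" unfolding A_def by (simp add: sum_nonneg)
  have v: "0 \<le> v" "v \<le> 2/3" using r by (auto simp: v_def)
  have \<mu>: "3 * v^2 \<le> \<mu>" "\<mu> \<le> 4"
  proof -
    have "\<mu> - 3 * v^2 = v * (6 * r^2 - 2)" by (simp add: \<mu>_def v_def power2_eq_square algebra_simps)
    moreover have "0 \<le> v * (6 * r^2 - 2)" using v r by (intro mult_nonneg_nonneg) auto
    ultimately show "3 * v^2 \<le> \<mu>" by linarith
    show "\<mu> \<le> 4" unfolding \<mu>_def using v r mult_mono[of v 1 "1 + 3 * r^2" 4] by simp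
  qed
  \<comment> \<open>The term linear in the partial sum, carrying the third moment of the coin, integrates to zero.\<close>
  have exact: "biased_mean (Suc n) m (\<lambda>x. (centered_sum (Suc n) m b x)^4)
      = biased_mean n m (\<lambda>x. (centered_sum n m b x)^4) + 6 * v^2 * A * c^2 + \<mu> * c^4"
    if m: "\<And>j. j \<in> {1..Suc n} \<Longrightarrow> (m j)^2 = r^2"
  proof -
    have mr: "(m (Suc n))^2 = r^2" using m by simp
    have M2: "biased_mean n m (\<lambda>x. (centered_sum n m b x)^2) = v * A"
      unfolding v_def A_def using m by (intro centered_moment2) auto
    have lin: "biased_mean n m (\<lambda>x. \<phi> x - d * centered_sum n m b x) = biased_mean n m \<phi>" for \<phi> d
      using biased_mean_add[of n m \<phi> "\<lambda>x. (- d) * centered_sum n m b x"]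
        biased_mean_mult[of n m "- d" "centered_sum n m b"] centered_moment1[of n m b]
      by simp
    show ?thesis
      unfolding biased_mean_centered_sum_Suc[where \<phi> = "\<lambda>s. s^4"] two_point_moment4 biased_mean_add biased_mean_const lin
        biased_mean_mult M2 mr v_def[symmetric] c_def[symmetric]
      by (simp add: \<mu>_def power2_eq_square)
  qed
  have sumA: "(\<Sum>j=1..Suc n. (b j)^2) = A + c^2" by (simp add: A_def c_def)
  { case 1
    have "3 * v^2 * A^2 \<le> biased_mean n m (\<lambda>x. (centered_sum n m b x)^4)"
      unfolding A_def v_def using 1 by (intro Suc.IH) auto
    moreover have "3 * v^2 * c^4 \<le> \<mu> * c^4" using \<mu> by (intro mult_right_mono) auto
    moreover have "3 * v^2 * (A + c^2)^2 = 3 * v^2 * A^2 + 6 * v^2 * A * c^2 + 3 * v^2 * c^4"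
      by algebra
    ultimately have "3 * v^2 * (A + c^2)^2
        \<le> biased_mean (Suc n) m (\<lambda>x. (centered_sum (Suc n) m b x)^4)"
      using exact[OF 1] by linarith
    then show ?case by (simp only: sumA v_def) }
  { case 2
    have "biased_mean n m (\<lambda>x. (centered_sum n m b x)^4) \<le> 4 * A^2"
      unfolding A_def using 2 by (intro Suc.IH) auto
    moreover have "\<mu> * c^4 \<le> 4 * c^4" using \<mu> by (intro mult_right_mono) auto
    moreover have "6 * v^2 * (A * c^2) \<le> 8 * (A * c^2)"
    proof (rule mult_right_mono)
      show "6 * v^2 \<le> 8" using \<mu> by simp
    qed (use A in simp)
    moreover have "4 * (A + c^2)^2 = 4 * A^2 + 8 * (A * c^2) + 4 * c^4"
      by algebra
    ultimately have "biased_mean (Suc n) m (\<lambda>x. (centered_sum (Suc n) m b x)^4)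
        \<le> 4 * (A + c^2)^2"
      using exact[OF 2] by linarith
    then show ?case by (simp only: sumA) }
qed

text \<open>The odd moments of the coin depend on the sign of \<open>m j\<close>. The term linear in the partial sum
  has mean zero, and the cubic one is absorbed into its two even neighbours by
  \<open>2 * \<bar>c^3 * s^3\<bar> \<le> c^2 * s^4 + c^4 * s^2\<close>. The constant \<open>48\<close> is large enough for
  \<open>48 * (A + c^2)^3\<close> to dominate the resulting terms.\<close>

lemma centered_moment6:
  assumes "\<And>j. j \<in> {1..n} \<Longrightarrow> (m j)^2 = r^2" and r: "1/3 \<le> r^2" "r^2 \<le> 1"
  shows "biased_mean n m (\<lambda>x. (centered_sum n m b x)^6) \<le> 48 * (\<Sum>j=1..n. (b j)^2)^3"
  using assms(1)
proof (induction n)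
  case 0
  then show ?case by (simp add: biased_mean_def centered_sum_def)
next
  case (Suc n)
  define A where "A = (\<Sum>j=1..n. (b j)^2)"
  define v where "v = 1 - r^2"
  define c where "c = b (Suc n)"
  define \<mu> where "\<mu> = m (Suc n)"
  let ?S = "centered_sum n m b"
  have A: "0 \<le> A" unfolding A_def by (simp add: sum_nonneg)
  have v: "0 \<le> v" "v \<le> 1" using r by (auto simp: v_def)
  have \<mu>2: "\<mu>^2 = r^2" using Suc.prems by (simp add: \<mu>_def)
  then have \<mu>1: "\<bar>\<mu>\<bar> \<le> 1" using r by (simp only: abs_square_le_1[symmetric])
  have m1: "\<bar>m j\<bar> \<le> 1" if "j \<in> {1..n}" for j
    using Suc.prems[of j] that r by (simp add: abs_square_le_1[symmetric])
  have M2: "biased_mean n m (\<lambda>x. (?S x)^2) \<le> A"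
  proof -
    have "biased_mean n m (\<lambda>x. (?S x)^2) = v * A"
      unfolding v_def A_def using Suc.prems by (intro centered_moment2) auto
    then show ?thesis using v A by (simp add: mult_left_le_one_le)
  qed
  have M4: "biased_mean n m (\<lambda>x. (?S x)^4) \<le> 4 * A^2"
    unfolding A_def using Suc.prems r by (intro centered_moment4) auto
  have M6: "biased_mean n m (\<lambda>x. (?S x)^6) \<le> 48 * A^3"
    unfolding A_def using Suc.prems by (intro Suc.IH) auto
  define d where "d = - 24 * \<mu> * (1 - \<mu>^4) * c^5"
  have pt: "(1 + \<mu>) / 2 * (s + (1 - \<mu>) * c)^6 + (1 - \<mu>) / 2 * (s - (1 + \<mu>) * c)^6
      \<le> s^6 + (35 * c^2 * s^4 + (80 * c^4 * s^2 + (d * s + 16 * c^6)))" for s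
  proof -
    have v': "1 - \<mu>^2 = v" by (simp add: \<mu>2 v_def)
    have t1: "15 * v * c^2 * s^4 \<le> 15 * c^2 * s^4"
    proof -
      have "15 * v * c^2 * s^4 = v * (15 * c^2 * s^4)" by (simp only: mult_ac)
      also have "\<dots> \<le> 1 * (15 * c^2 * s^4)" by (intro mult_right_mono v) auto
      finally show ?thesis by simp
    qed
    have t2: "- 40 * \<mu> * v * c^3 * s^3 \<le> 20 * c^2 * s^4 + 20 * c^4 * s^2"
    proof -
      have "\<bar>\<mu> * v\<bar> \<le> 1" using \<mu>1 v by (simp add: abs_mult mult_le_one)
      then have "\<bar>\<mu> * v\<bar> * \<bar>c^3 * s^3\<bar> \<le> 1 * \<bar>c^3 * s^3\<bar>" by (intro mult_right_mono) auto
      then have "- (\<mu> * v * (c^3 * s^3)) \<le> \<bar>c^3 * s^3\<bar>"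
        by (metis abs_ge_minus_self abs_mult mult_1 order_trans)
      moreover have "2 * \<bar>c^3 * s^3\<bar> \<le> c^2 * s^4 + c^4 * s^2"
      proof -
        have "c^2 * s^4 + c^4 * s^2 - 2 * (c^3 * s^3) = (c * s)^2 * (s - c)^2" by algebra
        moreover have "c^2 * s^4 + c^4 * s^2 + 2 * (c^3 * s^3) = (c * s)^2 * (s + c)^2" by algebra
        moreover have "0 \<le> (c * s)^2 * (s - c)^2" "0 \<le> (c * s)^2 * (s + c)^2" by auto
        ultimately show ?thesis by linarith
      qed
      ultimately show ?thesis by (simp add: mult.assoc)
    qed
    have r4: "v * (1 + 3 * \<mu>^2) \<le> 4" using v r \<mu>2 mult_mono[of v 1 "1 + 3 * r^2" 4] by simp
    have t3: "15 * v * (1 + 3 * \<mu>^2) * c^4 * s^2 \<le> 60 * c^4 * s^2"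
    proof -
      have "15 * v * (1 + 3 * \<mu>^2) * c^4 * s^2 = (v * (1 + 3 * \<mu>^2)) * (15 * c^4 * s^2)"
        by (simp only: mult_ac)
      also have "\<dots> \<le> 4 * (15 * c^4 * s^2)" by (intro mult_right_mono r4) auto
      finally show ?thesis by simp
    qed
    have "\<mu>^4 \<le> 1" using \<mu>1 by (simp add: power_le_one_iff[of "\<bar>\<mu>\<bar>" 4, simplified])
    then have r6: "v * (1 + 10 * \<mu>^2 + 5 * \<mu>^4) \<le> 16"
      using v r \<mu>2 mult_mono[of v 1 "1 + 10 * \<mu>^2 + 5 * \<mu>^4" 16] by simp
    have t4: "v * (1 + 10 * \<mu>^2 + 5 * \<mu>^4) * c^6 \<le> 16 * c^6"
      using r6 by (intro mult_right_mono) auto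
    show ?thesis unfolding two_point_moment6 v' d_def using t1 t2 t3 t4 by linarith
  qed
  have "biased_mean (Suc n) m (\<lambda>x. (centered_sum (Suc n) m b x)^6)
     \<le> biased_mean n m (\<lambda>x. (?S x)^6 + (35 * c^2 * (?S x)^4 + (80 * c^4 * (?S x)^2
          + (d * ?S x + 16 * c^6))))"
    unfolding biased_mean_centered_sum_Suc[where \<phi> = "\<lambda>s. s^6"]
    by (intro biased_mean_mono m1) (use pt in \<open>auto simp: \<mu>_def c_def\<close>)
  also have "\<dots> = biased_mean n m (\<lambda>x. (?S x)^6) + (35 * c^2 * biased_mean n m (\<lambda>x. (?S x)^4)
      + (80 * c^4 * biased_mean n m (\<lambda>x. (?S x)^2) + 16 * c^6))"
    by (simp add: biased_mean_add biased_mean_mult biased_mean_const centered_moment1)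
  also have "\<dots> \<le> 48 * A^3 + (35 * c^2 * (4 * A^2) + (80 * c^4 * A + 16 * c^6))"
    by (intro add_mono M6 mult_left_mono M4 M2) auto
  also have "\<dots> \<le> 48 * (A + c^2)^3"
  proof -
    have "48 * (A + c^2)^3 - (48 * A^3 + (35 * c^2 * (4 * A^2) + (80 * c^4 * A + 16 * c^6)))
      = 4 * c^2 * A^2 + 64 * c^4 * A + 32 * c^6" by algebra
    also have "\<dots> \<ge> 0" using A by simp
    finally show ?thesis by simp
  qed
  finally show ?case by (simp add: A_def c_def)
qed

section \<open>First absolute moments of centered sums\<close>

lemma centered_abs_moment:
  assumes m: "\<And>j. j \<in> {1..n} \<Longrightarrow> (m j)^2 = r^2" and r: "r^2 < 1"
  shows "biased_mean n m (\<lambda>x. \<bar>centered_sum n m b x\<bar>) \<le> sqrt (1 - r^2) * sqrt (\<Sum>j=1..n. (b j)^2)"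
proof -
  define \<tau> where "\<tau> = sqrt ((1 - r^2) * (\<Sum>j=1..n. (b j)^2))"
  have \<tau>2: "\<tau>^2 = (1 - r^2) * (\<Sum>j=1..n. (b j)^2)" using r by (simp add: \<tau>_def sum_nonneg)
  have "0 \<le> \<tau>" using r by (simp add: \<tau>_def sum_nonneg)
  show ?thesis
  proof (cases "\<tau> = 0")
    case True
    then have "(\<Sum>j=1..n. (b j)^2) = 0" using \<tau>2 r by simp
    then have "\<forall>j\<in>{1..n}. b j = 0" by (simp add: sum_nonneg_eq_0_iff)
    then have "centered_sum n m b x = 0" for x by (simp add: centered_sum_def)
    then show ?thesis using r by (simp add: biased_mean_const sum_nonneg)
  next
    case False
    with \<open>0 \<le> \<tau>\<close> have "0 < \<tau>" by simp
    have pt: "\<bar>s\<bar> \<le> \<tau> / 2 + (1 / (2 * \<tau>)) * s^2" for s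
    proof -
      have "2 * \<tau> * \<bar>s\<bar> \<le> \<tau>^2 + s^2" using sum_squares_bound[of \<tau> "\<bar>s\<bar>"] by simp
      then show ?thesis using \<open>0 < \<tau>\<close> by (simp add: field_simps power2_eq_square)
    qed
    have "biased_mean n m (\<lambda>x. \<bar>centered_sum n m b x\<bar>)
        \<le> biased_mean n m (\<lambda>x. \<tau> / 2 + (1 / (2 * \<tau>)) * (centered_sum n m b x)^2)"
    proof (rule biased_mean_mono)
      show "\<bar>m j\<bar> \<le> 1" if "j \<in> {1..n}" for j
        using m[OF that] r by (simp add: abs_square_le_1[symmetric])
    qed (rule pt)
    also have "\<dots> = \<tau> / 2 + (1 / (2 * \<tau>)) * \<tau>^2"
      unfolding biased_mean_add biased_mean_mult biased_mean_const \<tau>2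
      by (subst centered_moment2[OF m]) auto
    also have "\<dots> = \<tau>" using \<open>0 < \<tau>\<close> by (simp add: field_simps power2_eq_square)
    finally show ?thesis by (simp add: \<tau>_def real_sqrt_mult)
  qed
qed

text \<open>The elementary bound \<open>\<bar>u\<bar> \<le> (1 + u^2) / 2\<close> has slack \<open>(1 - \<bar>u\<bar>)^2 / 2\<close>, which dominates
  \<open>\<epsilon> * (u^2 - 1)^2 = \<epsilon> * (1 - \<bar>u\<bar>)^2 * (1 + \<bar>u\<bar>)^2\<close> unless \<open>\<bar>u\<bar>\<close> is at least of order \<open>\<epsilon> powr (-1/2)\<close>;
  there the sextic term, being of second order in \<open>\<epsilon>\<close>, takes over. Averaging turns a fourth
  moment that exceeds \<open>1\<close> into a gain of order \<open>\<epsilon>\<close> at a cost of order \<open>\<epsilon>^2\<close>.\<close>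

lemma abs_le_sextic:
  fixes u \<epsilon> :: real
  assumes \<epsilon>: "0 < \<epsilon>" "\<epsilon> \<le> 1/8"
  shows "\<bar>u\<bar> \<le> (1 + u^2) / 2 - \<epsilon> * (u^2 - 1)^2 + 8 * \<epsilon>^2 * u^6"
proof -
  define w where "w = \<bar>u\<bar>"
  have w: "0 \<le> w" by (simp add: w_def)
  have "\<epsilon> * (w^2 - 1)^2 \<le> (1 - w)^2 / 2 + 8 * \<epsilon>^2 * w^6"
  proof (cases "\<epsilon> * (1 + w)^2 \<le> 1/2")
    case True
    have "\<epsilon> * (w^2 - 1)^2 = (\<epsilon> * (1 + w)^2) * (1 - w)^2" by algebra
    also have "\<dots> \<le> 1/2 * (1 - w)^2" using True by (intro mult_right_mono) auto
    also have "\<dots> \<le> (1 - w)^2 / 2 + 8 * \<epsilon>^2 * w^6" by simp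
    finally show ?thesis .
  next
    case False
    have w1: "1 \<le> w"
    proof (rule ccontr)
      assume "\<not> 1 \<le> w"
      then have "(1 + w)^2 \<le> 2^2" using w by (intro power_mono) auto
      then have "\<epsilon> * (1 + w)^2 \<le> 1/8 * 2^2" using \<epsilon> by (intro mult_mono) auto
      with False show False by simp
    qed
    then have "(1 + w)^2 \<le> (2 * w)^2" by (intro power_mono) auto
    then have "\<epsilon> * (1 + w)^2 \<le> \<epsilon> * (2 * w)^2" using \<epsilon> by (intro mult_left_mono) auto
    with False have big: "1 \<le> 8 * \<epsilon> * w^2" by (simp add: power_mult_distrib)
    have "(w^2 - 1)^2 \<le> (w^2)^2" using w1 by (intro power_mono) (auto simp: one_le_power)
    then have "\<epsilon> * (w^2 - 1)^2 \<le> \<epsilon> * w^4 * 1" using \<epsilon> by (simp flip: power_mult)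
    also have "\<dots> \<le> \<epsilon> * w^4 * (8 * \<epsilon> * w^2)" using \<epsilon> by (intro mult_left_mono big) auto
    also have "\<dots> = 8 * \<epsilon>^2 * w^6" by algebra
    also have "\<dots> \<le> (1 - w)^2 / 2 + 8 * \<epsilon>^2 * w^6" by simp
    finally show ?thesis .
  qed
  moreover have "(1 - w)^2 / 2 = (1 + w^2) / 2 - w"
    by (simp add: power2_eq_square field_simps)
  ultimately have "w \<le> (1 + w^2) / 2 - \<epsilon> * (w^2 - 1)^2 + 8 * \<epsilon>^2 * w^6"
    by linarith
  moreover have "w^2 = u^2" "w^6 = u^6" by (simp_all add: w_def power_even_abs)
  ultimately show ?thesis by (simp add: w_def)
qed

text \<open>Normalise to \<open>u = S / \<tau>\<close> with \<open>E u^2 = 1\<close>. Then \<open>E u^4 \<ge> 3\<close> gives \<open>E (u^2 - 1)^2 \<ge> 2\<close>, and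
  \<open>E u^6 \<le> 48 / v^3 \<le> 1200\<close> because \<open>v = 1 - r^2 \<ge> 9/25\<close>. Hence
  \<open>E \<bar>u\<bar> \<le> 1 - 2 * \<epsilon> + 8 * 1200 * \<epsilon>^2\<close>, and \<open>\<epsilon> = 1 / 9600\<close> makes the right-hand side \<open>1 - \<epsilon>\<close>.
  No such gain exists at \<open>r = 0\<close>: there \<open>\<bar>S\<bar>\<close> is constant when a single coefficient is nonzero.\<close>

lemma centered_abs_moment_improved:
  assumes m: "\<And>j. j \<in> {1..n} \<Longrightarrow> (m j)^2 = r^2" and r: "1/3 \<le> r^2" "r^2 \<le> 16/25"
  shows "biased_mean n m (\<lambda>x. \<bar>centered_sum n m b x\<bar>)
           \<le> (1 - 1/9600) * (sqrt (1 - r^2) * sqrt (\<Sum>j=1..n. (b j)^2))"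
proof -
  define A where "A = (\<Sum>j=1..n. (b j)^2)"
  define v where "v = 1 - r^2"
  define \<tau> where "\<tau> = sqrt v * sqrt A"
  let ?S = "centered_sum n m b"
  have A: "0 \<le> A" by (simp add: A_def sum_nonneg)
  have v: "9/25 \<le> v" using r by (simp add: v_def)
  have \<tau>2: "\<tau>^2 = v * A" using A v by (simp add: \<tau>_def power_mult_distrib)
  show ?thesis
  proof (cases "A = 0")
    case True
    then show ?thesis using centered_abs_moment[of n m r b, OF m] r by (simp add: A_def)
  next
    case False
    with A v have "0 < A" "0 < \<tau>" by (auto simp: \<tau>_def)
    have m1: "\<bar>m j\<bar> \<le> 1" if "j \<in> {1..n}" for j
      using m[OF that] r by (simp add: abs_square_le_1[symmetric])
    define \<epsilon> :: real where "\<epsilon> = 1/9600"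
    have M2: "biased_mean n m (\<lambda>x. (?S x)^2) = \<tau>^2"
      unfolding \<tau>2 v_def A_def by (intro centered_moment2 m)
    have M4: "3 * \<tau>^4 \<le> biased_mean n m (\<lambda>x. (?S x)^4)"
    proof -
      have "\<tau>^4 = (v * A)^2" by (simp flip: \<tau>2 power_mult)
      then show ?thesis
        using centered_moment4(1)[of n m r b, OF m] r by (simp add: v_def A_def power_mult_distrib)
    qed
    have M6: "biased_mean n m (\<lambda>x. (?S x)^6) \<le> 1200 * \<tau>^6"
    proof -
      have "(9/25)^3 \<le> v^3" using v by (intro power_mono) auto
      then have "48 * A^3 \<le> 1200 * (v^3 * A^3)" using \<open>0 < A\<close> by (simp add: power_divide)
      also have "\<dots> = 1200 * \<tau>^6" by (simp add: power_mult_distrib[symmetric] flip: \<tau>2 power_mult)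
      finally show ?thesis
        using centered_moment6[of n m r b, OF m] r by (simp add: A_def)
    qed
    have expand: "(1 + t^2) / 2 - \<epsilon> * (t^2 - 1)^2 + 8 * \<epsilon>^2 * t^6 = (1/2 - \<epsilon>)
        + ((1/2 + 2 * \<epsilon>) * t^2 + ((- \<epsilon>) * t^4 + 8 * \<epsilon>^2 * t^6))" for t
      by (simp add: field_simps) algebra
    have pt: "\<bar>s\<bar> \<le> \<tau> * ((1/2 - \<epsilon>) + ((1/2 + 2 * \<epsilon>) / \<tau>^2 * s^2
        + ((- \<epsilon>) / \<tau>^4 * s^4 + 8 * \<epsilon>^2 / \<tau>^6 * s^6)))" for s
    proof -
      have "\<bar>s / \<tau>\<bar> \<le> (1 + (s/\<tau>)^2) / 2 - \<epsilon> * ((s/\<tau>)^2 - 1)^2 + 8 * \<epsilon>^2 * (s/\<tau>)^6"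
        by (rule abs_le_sextic) (auto simp: \<epsilon>_def)
      also have "\<dots> = (1/2 - \<epsilon>) + ((1/2 + 2 * \<epsilon>) * (s/\<tau>)^2
        + ((- \<epsilon>) * (s/\<tau>)^4 + 8 * \<epsilon>^2 * (s/\<tau>)^6))"
        by (rule expand)
      finally have "\<bar>s\<bar> / \<tau> \<le> (1/2 - \<epsilon>) + ((1/2 + 2 * \<epsilon>) / \<tau>^2 * s^2
        + ((- \<epsilon>) / \<tau>^4 * s^4 + 8 * \<epsilon>^2 / \<tau>^6 * s^6))"
        using \<open>0 < \<tau>\<close> by (simp add: power_divide)
      then show ?thesis using \<open>0 < \<tau>\<close> by (simp add: pos_divide_le_eq mult.commute)
    qed
    have "biased_mean n m (\<lambda>x. \<bar>?S x\<bar>) \<le> biased_mean n m (\<lambda>x. \<tau> * ((1/2 - \<epsilon>)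
        + ((1/2 + 2 * \<epsilon>) / \<tau>^2 * (?S x)^2
        + ((- \<epsilon>) / \<tau>^4 * (?S x)^4 + 8 * \<epsilon>^2 / \<tau>^6 * (?S x)^6))))"
      by (intro biased_mean_mono m1 pt)
    also have "\<dots> = \<tau> * ((1/2 - \<epsilon>) + ((1/2 + 2 * \<epsilon>) / \<tau>^2 * \<tau>^2
        + ((- \<epsilon>) / \<tau>^4 * biased_mean n m (\<lambda>x. (?S x)^4)
           + 8 * \<epsilon>^2 / \<tau>^6 * biased_mean n m (\<lambda>x. (?S x)^6))))"
      unfolding biased_mean_add biased_mean_mult biased_mean_const M2 ..
    also have "\<dots> \<le> \<tau> * ((1/2 - \<epsilon>) + ((1/2 + 2 * \<epsilon>) / \<tau>^2 * \<tau>^2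
        + ((- \<epsilon>) / \<tau>^4 * (3 * \<tau>^4) + 8 * \<epsilon>^2 / \<tau>^6 * (1200 * \<tau>^6))))"
      using \<open>0 < \<tau>\<close>
      by (intro mult_left_mono add_mono order_refl M6 mult_left_mono_neg[OF M4]) (auto simp: \<epsilon>_def)
    also have "\<dots> = (1 - 1/9600) * \<tau>" using \<open>0 < \<tau>\<close> by (simp add: \<epsilon>_def field_simps)
    finally show ?thesis by (simp add: \<tau>_def v_def A_def)
  qed
qed


section \<open>Interpolation along the noise semigroup\<close>

text \<open>The weight at \<open>x\<close> of the product measure with means \<open>r * y j\<close>, that is, the kernel of the
  noise operator \<open>P\<^sub>r\<close>; it is the heat semigroup of the cube at time \<open>- ln r\<close>.\<close>

definition noise_kernel :: "nat \<Rightarrow> real \<Rightarrow> (nat \<Rightarrow> real) \<Rightarrow> (nat \<Rightarrow> real) \<Rightarrow> real" where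
  "noise_kernel n r y x = (\<Prod>j=1..n. (1 + r * y j * x j) / 2)"

definition noise_pairing ::
    "nat \<Rightarrow> ((nat \<Rightarrow> real) \<Rightarrow> real) \<Rightarrow> ((nat \<Rightarrow> real) \<Rightarrow> real) \<Rightarrow> real \<Rightarrow> real" where
  "noise_pairing n f g r =
     (\<Sum>y\<in>hamming_cube n. f y * (\<Sum>x\<in>hamming_cube n. noise_kernel n r y x * g x)) / 2 ^ n"

lemma biased_mean_noise_kernel:
  "biased_mean n (\<lambda>j. r * y j) \<phi> = (\<Sum>x\<in>hamming_cube n. noise_kernel n r y x * \<phi> x)"
  by (simp add: biased_mean_def noise_kernel_def)

lemma noise_pairing_0: "noise_pairing n f g 0 = cube_expectation n f * cube_expectation n g"
proof -
  have "noise_kernel n 0 y x = 1 / 2 ^ n" for y x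
    by (simp add: noise_kernel_def power_one_over)
  then have "noise_pairing n f g 0
      = (\<Sum>y\<in>hamming_cube n. f y * (1 / 2 ^ n * (\<Sum>x\<in>hamming_cube n. g x))) / 2 ^ n"
    by (simp only: noise_pairing_def sum_distrib_left[symmetric])
  then show ?thesis
    by (simp only: sum_distrib_right[symmetric]) (simp add: cube_expectation_sum)
qed

lemma noise_pairing_1: "noise_pairing n f g 1 = cube_expectation n (\<lambda>x. f x * g x)"
proof -
  have "(\<Sum>x\<in>hamming_cube n. noise_kernel n 1 y x * g x) = g y" if y: "y \<in> hamming_cube n" for y
  proof -
    have diag: "noise_kernel n 1 y y = 1"
    proof -
      have "(1 + 1 * y j * y j) / 2 = 1" if "j \<in> {1..n}" for j
        using hamming_cube_values[OF y that] by auto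
      then show ?thesis unfolding noise_kernel_def by (intro prod.neutral) auto
    qed
    have off: "noise_kernel n 1 y x = 0" if x: "x \<in> hamming_cube n" "x \<noteq> y" for x
    proof -
      obtain j where j: "j \<in> {1..n}" "x j \<noteq> y j"
        using x y unfolding hamming_cube_def by (metis PiE_ext)
      then have "(1 + 1 * y j * x j) / 2 = 0"
        using hamming_cube_values[OF y j(1)] hamming_cube_values[OF x(1) j(1)] by auto
      then show ?thesis unfolding noise_kernel_def using j(1) by (intro prod_zero) auto
    qed
    have "(\<Sum>x\<in>hamming_cube n. noise_kernel n 1 y x * g x)
        = (\<Sum>x\<in>hamming_cube n. if x = y then g y else 0)"
      using diag off by (intro sum.cong) auto
    then show ?thesis using y by (simp add: finite_hamming_cube)
  qed
  then show ?thesis by (simp add: noise_pairing_def cube_expectation_sum)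
qed

lemma noise_kernel_remove:
  assumes "j \<in> {1..n}"
  shows "noise_kernel n r y x
    = (1 + r * y j * x j) / 2 * (\<Prod>i\<in>{1..n} - {j}. (1 + r * y i * x i) / 2)"
  unfolding noise_kernel_def using assms by (intro prod.remove) auto

lemma two_point_score:
  assumes "s = 1 \<or> s = -1" "t = 1 \<or> t = (-1::real)"
  shows "(1 + r * t * s) / 2 * (s * t - r) = s * t / 2 * (1 - r\<^sup>2)"
  using assms by (auto simp: power2_eq_square field_simps)

text \<open>Each factor has logarithmic derivative \<open>s / (1 + r * s)\<close> with \<open>s = x j * y j\<close>. Since
  \<open>s\<^sup>2 = 1\<close>, this equals the centered expression \<open>(s - r) / (1 - r\<^sup>2)\<close>.\<close>

lemma noise_kernel_deriv:
  assumes x: "x \<in> hamming_cube n" and y: "y \<in> hamming_cube n" and r: "r\<^sup>2 \<noteq> 1"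
  shows "((\<lambda>r. noise_kernel n r y x) has_real_derivative
     (\<Sum>j=1..n. noise_kernel n r y x * (x j * y j - r)) / (1 - r\<^sup>2)) (at r)"
proof -
  have "((\<lambda>r. noise_kernel n r y x) has_real_derivative
     (\<Sum>j=1..n. x j * y j / 2 * (\<Prod>i\<in>{1..n} - {j}. (1 + r * y i * x i) / 2))) (at r)"
    unfolding noise_kernel_def
    by (rule has_field_derivative_prod) (auto intro!: derivative_eq_intros)
  moreover have "x j * y j / 2 * (\<Prod>i\<in>{1..n} - {j}. (1 + r * y i * x i) / 2)
      = noise_kernel n r y x * (x j * y j - r) / (1 - r\<^sup>2)" if j: "j \<in> {1..n}" for j
  proof -
    let ?P = "\<Prod>i\<in>{1..n} - {j}. (1 + r * y i * x i) / 2"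
    have "noise_kernel n r y x * (x j * y j - r)
        = ((1 + r * y j * x j) / 2 * (x j * y j - r)) * ?P"
      unfolding noise_kernel_remove[OF j] by (simp only: mult_ac)
    also have "\<dots> = (x j * y j / 2 * (1 - r\<^sup>2)) * ?P"
      by (simp only: two_point_score[OF hamming_cube_values[OF x j] hamming_cube_values[OF y j]])
    finally show ?thesis using r by simp
  qed
  ultimately show ?thesis
    by (simp only: sum_divide_distrib cong: sum.cong)
qed

lemma sum_hamming_cube_flip:
  assumes "j \<in> {1..n}"
  shows "(\<Sum>y\<in>hamming_cube n. \<phi> (y(j := - y j))) = (\<Sum>y\<in>hamming_cube n. \<phi> y)"
  by (rule sum.reindex_bij_witness[of _ "\<lambda>y. y(j := - y j)" "\<lambda>y. y(j := - y j)"])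
     (use assms in \<open>auto simp: hamming_cube_def PiE_def Pi_def extensional_def\<close>)

text \<open>Split \<open>f\<close> into its average over coordinate \<open>j\<close> and \<open>y j * discrete_partial j f y\<close>. By
  \<open>two_point_score\<close>, the weight times \<open>x j * y j - r\<close> is odd in \<open>y j\<close>, so the average
  contributes nothing; in the other part \<open>(x j * y j - r) * y j = x j - r * y j\<close>.\<close>

lemma noise_kernel_partial:
  assumes x: "x \<in> hamming_cube n" and j: "j \<in> {1..n}"
  shows "(\<Sum>y\<in>hamming_cube n. noise_kernel n r y x * (x j * y j - r) * f y)
     = (\<Sum>y\<in>hamming_cube n. noise_kernel n r y x * (x j - r * y j) * discrete_partial j f y)"
proof -
  define P where "P y = (\<Prod>i\<in>{1..n} - {j}. (1 + r * y i * x i) / 2)" for y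
  define avg where "avg y = (f (y(j := 1)) + f (y(j := -1))) / 2" for y
  define T where "T y = x j * y j / 2 * (1 - r\<^sup>2) * P y * avg y" for y
  have "P (y(j := - y j)) = P y" for y
    unfolding P_def by (rule prod.cong) auto
  then have "T (y(j := - y j)) = - T y" for y by (simp add: T_def avg_def)
  then have "(\<Sum>y\<in>hamming_cube n. T y) = - (\<Sum>y\<in>hamming_cube n. T y)"
    using sum_hamming_cube_flip[OF j, of T] by (simp add: sum_negf)
  then have T0: "(\<Sum>y\<in>hamming_cube n. T y) = 0" by simp
  have "noise_kernel n r y x * (x j * y j - r) * f y
      = T y + noise_kernel n r y x * (x j - r * y j) * discrete_partial j f y"
    if y: "y \<in> hamming_cube n" for y
  proof -
    have yj: "y j = 1 \<or> y j = -1" using hamming_cube_values[OF y j] .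
    have split: "f y = avg y + y j * discrete_partial j f y"
      using yj by (auto simp: avg_def discrete_partial_def field_simps fun_upd_idem)
    have "T y = noise_kernel n r y x * (x j * y j - r) * avg y"
    proof -
      have "T y = (1 + r * y j * x j) / 2 * (x j * y j - r) * P y * avg y"
        unfolding T_def two_point_score[OF hamming_cube_values[OF x j] yj] ..
      then show ?thesis unfolding noise_kernel_remove[OF j] P_def by (simp only: mult_ac)
    qed
    moreover have "(x j * y j - r) * y j = x j - r * y j" using yj by auto
    ultimately show ?thesis
      by (subst split) (simp only: distrib_left mult.assoc[symmetric],
        simp only: mult.assoc)
  qed
  then show ?thesis using T0 by (simp add: sum.distrib)
qed

lemma noise_pairing_deriv:
  assumes r: "r\<^sup>2 \<noteq> 1"
  shows "(noise_pairing n f g has_real_derivative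
     cube_expectation n (\<lambda>y. biased_mean n (\<lambda>j. r * y j)
       (\<lambda>x. g x * centered_sum n (\<lambda>j. r * y j) (\<lambda>j. discrete_partial j f y) x)) / (1 - r\<^sup>2)) (at r)"
proof -
  let ?Q = "hamming_cube n" and ?K = "\<lambda>y x. noise_kernel n r y x"
  have "(noise_pairing n f g has_real_derivative
     (\<Sum>y\<in>?Q. f y * (\<Sum>x\<in>?Q. (\<Sum>j=1..n. ?K y x * (x j * y j - r)) / (1 - r\<^sup>2) * g x)) / 2 ^ n) (at r)"
    unfolding noise_pairing_def[abs_def]
    by (intro DERIV_cdivide DERIV_sum DERIV_cmult DERIV_cmult_right noise_kernel_deriv r)
  also have "(\<Sum>y\<in>?Q. f y * (\<Sum>x\<in>?Q. (\<Sum>j=1..n. ?K y x * (x j * y j - r)) / (1 - r\<^sup>2) * g x))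
     = (\<Sum>y\<in>?Q. \<Sum>x\<in>?Q. \<Sum>j=1..n. ?K y x * (x j * y j - r) * f y * g x) / (1 - r\<^sup>2)"
    by (simp add: sum_distrib_left sum_distrib_right sum_divide_distrib mult_ac)
  also have "(\<Sum>y\<in>?Q. \<Sum>x\<in>?Q. \<Sum>j=1..n. ?K y x * (x j * y j - r) * f y * g x)
     = (\<Sum>x\<in>?Q. \<Sum>j=1..n. \<Sum>y\<in>?Q. ?K y x * (x j * y j - r) * f y * g x)"
    by (subst sum.swap) (intro sum.cong refl sum.swap)
  also have "\<dots> = (\<Sum>x\<in>?Q. \<Sum>j=1..n. \<Sum>y\<in>?Q. ?K y x * (x j - r * y j) * discrete_partial j f y * g x)"
    by (rule sum.cong[OF refl], rule sum.cong[OF refl])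
       (simp only: noise_kernel_partial sum_distrib_right[symmetric])
  also have "\<dots> = (\<Sum>y\<in>?Q. \<Sum>x\<in>?Q. \<Sum>j=1..n. ?K y x * (x j - r * y j) * discrete_partial j f y * g x)"
    by (subst (2) sum.swap) (intro sum.cong refl sum.swap)
  also have "\<dots> = (\<Sum>y\<in>?Q. biased_mean n (\<lambda>j. r * y j)
       (\<lambda>x. g x * centered_sum n (\<lambda>j. r * y j) (\<lambda>j. discrete_partial j f y) x))"
    by (simp add: biased_mean_noise_kernel centered_sum_def sum_distrib_left mult_ac)
  finally show ?thesis by (simp add: cube_expectation_sum mult.commute)
qed

lemma cube_expectation_mono:
  assumes "\<And>x. x \<in> hamming_cube n \<Longrightarrow> \<phi> x \<le> \<psi> x"
  shows "cube_expectation n \<phi> \<le> cube_expectation n \<psi>"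
  unfolding cube_expectation_sum by (intro divide_right_mono sum_mono assms) auto

lemma cube_expectation_mult: "cube_expectation n (\<lambda>x. c * \<phi> x) = c * cube_expectation n \<phi>"
  by (simp add: cube_expectation_sum sum_distrib_left)

lemma cube_expectation_diff:
  "cube_expectation n (\<lambda>x. \<phi> x - \<psi> x) = cube_expectation n \<phi> - cube_expectation n \<psi>"
  by (simp add: cube_expectation_sum sum_subtractf diff_divide_distrib)

lemma noise_pairing_deriv_bound:
  assumes r: "r\<^sup>2 < 1"
    and g: "\<And>x. \<bar>g x\<bar> \<le> 1"
    and \<kappa>: "\<And>m b. (\<And>j. j \<in> {1..n} \<Longrightarrow> (m j)\<^sup>2 = r\<^sup>2) \<Longrightarrow>
      biased_mean n m (\<lambda>x. \<bar>centered_sum n m b x\<bar>) \<le> \<kappa> * (sqrt (1 - r\<^sup>2) * sqrt (\<Sum>j=1..n. (b j)\<^sup>2))"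
  shows "\<exists>D. (noise_pairing n f g has_real_derivative D) (at r)
    \<and> D \<le> \<kappa> * cube_expectation n (gradient_norm n f) / sqrt (1 - r\<^sup>2)"
proof (intro exI conjI)
  let ?S = "\<lambda>y. centered_sum n (\<lambda>j. r * y j) (\<lambda>j. discrete_partial j f y)"
  let ?D = "cube_expectation n (\<lambda>y. biased_mean n (\<lambda>j. r * y j) (\<lambda>x. g x * ?S y x)) / (1 - r\<^sup>2)"
  show "(noise_pairing n f g has_real_derivative ?D) (at r)"
    using r by (intro noise_pairing_deriv) auto
  have "cube_expectation n (\<lambda>y. biased_mean n (\<lambda>j. r * y j) (\<lambda>x. g x * ?S y x))
      \<le> cube_expectation n (\<lambda>y. (\<kappa> * sqrt (1 - r\<^sup>2)) * gradient_norm n f y)"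
  proof (rule cube_expectation_mono)
    fix y assume y: "y \<in> hamming_cube n"
    have m: "(r * y j)\<^sup>2 = r\<^sup>2" if "j \<in> {1..n}" for j
      using hamming_cube_values[OF y that] by (auto simp: power_mult_distrib)
    have "biased_mean n (\<lambda>j. r * y j) (\<lambda>x. g x * ?S y x)
        \<le> biased_mean n (\<lambda>j. r * y j) (\<lambda>x. \<bar>?S y x\<bar>)"
    proof (rule biased_mean_mono)
      show "\<bar>r * y j\<bar> \<le> 1" if "j \<in> {1..n}" for j
        using m[OF that] r by (simp only: abs_square_le_1[symmetric])
      show "g x * ?S y x \<le> \<bar>?S y x\<bar>" for x
        using abs_ge_self[of "g x * ?S y x"] mult_right_mono[OF g, of "\<bar>?S y x\<bar>" x]
        by (simp add: abs_mult)
    qed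
    also have "\<dots> \<le> \<kappa> * (sqrt (1 - r\<^sup>2) * sqrt (\<Sum>j=1..n. (discrete_partial j f y)\<^sup>2))"
      using m by (rule \<kappa>)
    finally show "biased_mean n (\<lambda>j. r * y j) (\<lambda>x. g x * ?S y x)
        \<le> (\<kappa> * sqrt (1 - r\<^sup>2)) * gradient_norm n f y"
      by (simp add: gradient_norm_def)
  qed
  then have "?D \<le> (\<kappa> * sqrt (1 - r\<^sup>2)) * cube_expectation n (gradient_norm n f) / (1 - r\<^sup>2)"
    unfolding cube_expectation_mult using r by (intro divide_right_mono) auto
  also have "\<dots> = \<kappa> * cube_expectation n (gradient_norm n f) / sqrt (1 - r\<^sup>2)"
  proof -
    define t where "t = sqrt (1 - r\<^sup>2)"
    have t: "0 < t" "1 - r\<^sup>2 = t * t" using r by (simp_all add: t_def)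
    show ?thesis unfolding t_def[symmetric] t(2) using t(1) by simp
  qed
  finally show "?D \<le> \<kappa> * cube_expectation n (gradient_norm n f) / sqrt (1 - r\<^sup>2)" .
qed

text \<open>The derivative bound is integrated by monotonicity of the difference with the arcsine, whose
  derivative is \<open>1 / sqrt (1 - r\<^sup>2)\<close>. Only the open interval enters, so the singularity at
  \<open>r = 1\<close> is harmless. The factor \<open>\<kappa>\<close> is a parameter so that the Cauchy--Schwarz bound and
  its improvement can be used on different subintervals.\<close>

lemma noise_pairing_increment:
  assumes ab: "-1 < a" "a \<le> b" "b \<le> 1"
    and g: "\<And>x. \<bar>g x\<bar> \<le> 1"
    and \<kappa>: "\<And>m b' r. a < r \<Longrightarrow> r < b \<Longrightarrow> (\<And>j. j \<in> {1..n} \<Longrightarrow> (m j)\<^sup>2 = r\<^sup>2) \<Longrightarrow>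
      biased_mean n m (\<lambda>x. \<bar>centered_sum n m b' x\<bar>) \<le> \<kappa> * (sqrt (1 - r\<^sup>2) * sqrt (\<Sum>j=1..n. (b' j)\<^sup>2))"
  shows "noise_pairing n f g b - noise_pairing n f g a
    \<le> \<kappa> * cube_expectation n (gradient_norm n f) * (arcsin b - arcsin a)"
proof -
  define G where "G = \<kappa> * cube_expectation n (gradient_norm n f)"
  let ?H = "\<lambda>r. G * arcsin r - noise_pairing n f g r"
  have "?H a \<le> ?H b"
  proof (rule DERIV_nonneg_imp_increasing_open[OF ab(2)])
    fix r assume r: "a < r" "r < b"
    then have r1: "-1 < r" "r < 1" using ab by auto
    then have r2: "r\<^sup>2 < 1" by (simp add: abs_square_less_1 abs_less_iff)
    have "\<exists>D. (noise_pairing n f g has_real_derivative D) (at r) \<and> D \<le> G / sqrt (1 - r\<^sup>2)"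
      unfolding G_def by (rule noise_pairing_deriv_bound[OF r2]) (fact g, rule \<kappa>[OF r])
    then obtain D where D: "(noise_pairing n f g has_real_derivative D) (at r)"
      "D \<le> G / sqrt (1 - r\<^sup>2)" by blast
    have "(?H has_real_derivative G * inverse (sqrt (1 - r\<^sup>2)) - D) (at r)"
      by (intro DERIV_diff DERIV_cmult DERIV_arcsin r1 D)
    moreover have "0 \<le> G * inverse (sqrt (1 - r\<^sup>2)) - D" using D(2) by (simp add: divide_inverse)
    ultimately show "\<exists>y. (?H has_real_derivative y) (at r) \<and> 0 \<le> y" by blast
  next
    have "continuous_on {a..b} (noise_pairing n f g)"
      unfolding noise_pairing_def noise_kernel_def divide_inverse by (intro continuous_intros)
    then show "continuous_on {a..b} ?H"
      by (intro continuous_on_diff continuous_on_mult continuous_on_const continuous_on_id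
          continuous_on_arcsin) (use ab in auto)
  qed
  then show ?thesis by (simp add: G_def algebra_simps)
qed

definition arcsin_gap :: real where
  "arcsin_gap = (arcsin (4/5) - arcsin (3/5)) / 9600"

text \<open>The interval \<open>[3/5, 4/5]\<close> satisfies \<open>1/3 \<le> r\<^sup>2 \<le> 16/25\<close>, as the improved moment bound
  requires; the Cauchy--Schwarz bound serves on the two remaining pieces of \<open>[0, 1]\<close>.\<close>

lemma L1_Poincare_improved: "L1_Poincare (pi / 2 - arcsin_gap)"
  unfolding L1_Poincare_def
proof (intro allI impI)
  fix n :: nat and f :: "(nat \<Rightarrow> real) \<Rightarrow> real"
  define G where "G = cube_expectation n (gradient_norm n f)"
  define \<mu> where "\<mu> = cube_expectation n f"
  define g where "g x = sgn (f x - \<mu>)" for x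
  have g: "\<bar>g x\<bar> \<le> 1" for x by (simp add: g_def abs_sgn_eq)
  have outer: "noise_pairing n f g b - noise_pairing n f g a \<le> 1 * G * (arcsin b - arcsin a)"
    if ab: "0 \<le> a" "a \<le> b" "b \<le> 1" for a b
    unfolding G_def
  proof (rule noise_pairing_increment[OF _ ab(2,3) g])
    show "biased_mean n m (\<lambda>x. \<bar>centered_sum n m b' x\<bar>)
        \<le> 1 * (sqrt (1 - r\<^sup>2) * sqrt (\<Sum>j=1..n. (b' j)\<^sup>2))"
      if "a < r" "r < b" "\<And>j. j \<in> {1..n} \<Longrightarrow> (m j)\<^sup>2 = r\<^sup>2" for m b' r
      using centered_abs_moment[of n m r b'] that ab by (simp add: abs_square_less_1)
  qed (use ab in simp)
  have inner: "noise_pairing n f g (4/5) - noise_pairing n f g (3/5)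
      \<le> (1 - 1/9600) * G * (arcsin (4/5) - arcsin (3/5))"
    unfolding G_def
  proof (rule noise_pairing_increment[OF _ _ _ g])
    show "biased_mean n m (\<lambda>x. \<bar>centered_sum n m b' x\<bar>)
        \<le> (1 - 1/9600) * (sqrt (1 - r\<^sup>2) * sqrt (\<Sum>j=1..n. (b' j)\<^sup>2))"
      if r: "3/5 < r" "r < 4/5" and m: "\<And>j. j \<in> {1..n} \<Longrightarrow> (m j)\<^sup>2 = r\<^sup>2" for m b' r
    proof (rule centered_abs_moment_improved[OF m])
      have "(3/5)\<^sup>2 \<le> r\<^sup>2" using r by (intro power_mono) auto
      then show "1/3 \<le> r\<^sup>2" by (simp add: power_divide)
      have "r\<^sup>2 \<le> (4/5)\<^sup>2" using r by (intro power_mono) auto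
      then show "r\<^sup>2 \<le> 16/25" by (simp add: power_divide)
    qed
  qed auto
  have "cube_expectation n (\<lambda>x. \<bar>f x - \<mu>\<bar>) = cube_expectation n (\<lambda>x. f x * g x - \<mu> * g x)"
    by (simp add: g_def abs_sgn left_diff_distrib)
  also have "\<dots> = noise_pairing n f g 1 - noise_pairing n f g 0"
    unfolding cube_expectation_diff cube_expectation_mult noise_pairing_0 noise_pairing_1 \<mu>_def ..
  also have "\<dots> \<le> G * (arcsin 1 - arcsin (4/5)) + (1 - 1/9600) * G * (arcsin (4/5) - arcsin (3/5))
      + G * (arcsin (3/5) - arcsin 0)"
    using outer[of 0 "3/5"] inner outer[of "4/5" 1] by simp
  also have "\<dots> = (pi / 2 - arcsin_gap) * G"
    unfolding arcsin_gap_def arcsin_0 arcsin_1 by algebra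
  finally show "cube_expectation n (\<lambda>x. \<bar>f x - cube_expectation n f\<bar>)
      \<le> (pi / 2 - arcsin_gap) * cube_expectation n (gradient_norm n f)"
    by (simp add: \<mu>_def G_def)
qed

section \<open>The optimal constant\<close>

text \<open>One function with nonzero gradient suffices to bound the admissible constants below.\<close>

lemma L1_Poincare_nonneg:
  assumes "L1_Poincare C"
  shows "0 \<le> C"
proof -
  let ?f = "\<lambda>x :: nat \<Rightarrow> real. x 1"
  have "gradient_norm 1 ?f = (\<lambda>x. 1)"
    by (simp add: gradient_norm_def discrete_partial_def fun_eq_iff)
  then have "cube_expectation 1 (gradient_norm 1 ?f) = 1"
    by (simp add: cube_expectation_def)
  moreover have "0 \<le> cube_expectation 1 (\<lambda>x. \<bar>?f x - cube_expectation 1 ?f\<bar>)"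
    by (simp add: cube_expectation_sum sum_nonneg)
  moreover have "cube_expectation 1 (\<lambda>x. \<bar>?f x - cube_expectation 1 ?f\<bar>)
      \<le> C * cube_expectation 1 (gradient_norm 1 ?f)"
    by (rule assms[unfolded L1_Poincare_def, rule_format]) simp
  ultimately show ?thesis by simp
qed

text \<open>For fixed \<open>f\<close> the condition on \<open>C\<close> is a closed one, \<open>L \<le> C * G\<close> with \<open>G \<ge> 0\<close>, so the
  infimum of the admissible constants is itself admissible.\<close>

lemma L1_Poincare_least:
  "L1_Poincare C\<^sub>1 \<and> (\<forall>C. L1_Poincare C \<longrightarrow> C\<^sub>1 \<le> C)"
proof -
  define I where "I = Inf {C. L1_Poincare C}"
  have ne: "{C. L1_Poincare C} \<noteq> {}" using L1_Poincare_improved by auto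
  have bdd: "bdd_below {C. L1_Poincare C}"
    by (intro bdd_belowI[where m = 0]) (simp add: L1_Poincare_nonneg)
  have lower: "I \<le> C" if "L1_Poincare C" for C
    unfolding I_def using that bdd by (intro cInf_lower) auto
  have "L1_Poincare I"
    unfolding L1_Poincare_def
  proof (intro allI impI)
    fix n :: nat and f :: "(nat \<Rightarrow> real) \<Rightarrow> real"
    assume n: "1 \<le> n"
    define L where "L = cube_expectation n (\<lambda>x. \<bar>f x - cube_expectation n f\<bar>)"
    define G where "G = cube_expectation n (gradient_norm n f)"
    have le: "L \<le> C * G" if "L1_Poincare C" for C
      using that n unfolding L1_Poincare_def L_def G_def by blast
    have "0 \<le> G"
      by (simp add: G_def cube_expectation_sum gradient_norm_def sum_nonneg)
    have "L \<le> I * G"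
    proof (cases "G = 0")
      case True
      then show ?thesis using le[OF L1_Poincare_improved] by simp
    next
      case False
      with \<open>0 \<le> G\<close> have "0 < G" by simp
      then have "L / G \<le> I"
        unfolding I_def using le by (intro cInf_greatest ne) (simp add: pos_divide_le_eq)
      then show ?thesis using \<open>0 < G\<close> by (simp add: pos_divide_le_eq)
    qed
    then show "cube_expectation n (\<lambda>x. \<bar>f x - cube_expectation n f\<bar>)
        \<le> I * cube_expectation n (gradient_norm n f)"
      by (simp add: L_def G_def)
  qed
  moreover have "C\<^sub>1 = I"
    unfolding C\<^sub>1_def by (rule Least_equality) (use calculation lower in auto)
  ultimately show ?thesis using lower by simp
qed

theorem mainTheorem1:
  "L1_Poincare C\<^sub>1 \<and> (\<forall>C. L1_Poincare C \<longrightarrow> C\<^sub>1 \<le> C) \<and> C\<^sub>1 < pi / 2"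
proof -
  have "arcsin (3/5) < arcsin (4/5 :: real)" by (rule arcsin_less_arcsin) auto
  then have "0 < arcsin_gap" by (simp add: arcsin_gap_def)
  moreover have "C\<^sub>1 \<le> pi / 2 - arcsin_gap"
    using L1_Poincare_least L1_Poincare_improved by blast
  ultimately show ?thesis using L1_Poincare_least by auto
qed

end
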